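(* Let $c\in\mathbb C^4$ have at least one zero entry, and let $c_i,c_j,c_k$ be the other three entries (so that $\{i,j,k,\ell\}=\{1,2,3,4\}$ and $c_\ell=0$). Then: (i) if the three numbers $|c_i|,|c_j|,|c_k|$ do not make a triangle, or make an obtuse or right triangle, then $\|c\|_{\mathsf X}'=\|c\|_\infty$; (ii) if the three numbers $|c_i|,|c_j|,|c_k|$ make an acute triangle, then $$\|c\|_{\mathsf X}'=\frac{2|c_ic_jc_k|}{\sqrt{(|c_i|+|c_j|+|c_k|)(-|c_i|+|c_j|+|c_k|)(|c_i|-|c_j|+|c_k|)(|c_i|+|c_j|-|c_k|)}}.$$
   Context: On $\mathbb C^4$ define the norm $\|z\|_{\mathsf X}=\max_{\sigma\in\mathbb R}\left(|z_1e^{\mathrm i\sigma}+\bar z_4|+|z_2e^{\mathrm i\sigma}+\bar z_3|\right)$ and its dual norm $\|c\|_{\mathsf X}'=\max\{|\langle c,z\rangle|:\|z\|_{\mathsf X}=1\}$, where $\langle c,z\rangle=\sum_{i=1}^4c_iz_i$ (bilinear). Also $\|c\|_\infty=\max_{1\le j\le 4}|c_j|$. Three nonnegative numbers "make a triangle" if they are the side lengths of a non-degenerate triangle, i.e. each is strictly less than the sum of the other two; the triangle is acute, right or obtuse according to its largest angle. *)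

theory Defs
  imports "HOL-Analysis.Analysis"
begin

text \<open>
  Vectors of \<open>\<complex>\<^sup>4\<close> are elements of \<^typ>\<open>complex ^ 4\<close>.  The index type \<^typ>\<open>4\<close> consists of the
  four distinct numerals \<open>1, 2, 3, 4\<close> (arithmetic is modulo \<open>4\<close>, so \<open>4\<close> is the same index
  as \<open>0\<close>).
\<close>

definition xphase :: "complex ^ 4 \<Rightarrow> real \<Rightarrow> real" where
  "xphase z \<sigma> = cmod (z $ 1 * exp (\<i> * of_real \<sigma>) + cnj (z $ 4)) +
                cmod (z $ 2 * exp (\<i> * of_real \<sigma>) + cnj (z $ 3))"

text \<open>
  The maxima over infinite sets are written as suprema; they are attained, see
  \<open>xnorm_attained\<close> and \<open>dual_xnorm_attained\<close> below.
\<close>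

definition xnorm :: "complex ^ 4 \<Rightarrow> real" where
  "xnorm z = (SUP \<sigma>. xphase z \<sigma>)"

definition pairing :: "complex ^ 4 \<Rightarrow> complex ^ 4 \<Rightarrow> complex" where
  "pairing c z = (\<Sum>i\<in>UNIV. c $ i * z $ i)"

definition dual_xnorm :: "complex ^ 4 \<Rightarrow> real" where
  "dual_xnorm c = (SUP z\<in>{z. xnorm z = 1}. cmod (pairing c z))"

text \<open>
  Not the library's \<^const>\<open>infnorm\<close>, which on \<^typ>\<open>complex ^ 4\<close> maximises over real and
  imaginary parts instead of moduli.
\<close>

definition linfnorm :: "complex ^ 4 \<Rightarrow> real" where
  "linfnorm c = (MAX j. cmod (c $ j))"

definition makes_triangle :: "real \<Rightarrow> real \<Rightarrow> real \<Rightarrow> bool" where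
  "makes_triangle a b c \<longleftrightarrow> a < b + c \<and> b < a + c \<and> c < a + b"

text \<open>
  The angle opposite to the side of length \<open>a\<close> in a triangle with side lengths \<open>a, b, c\<close>, by the
  law of cosines; \<open>opp_angle_eq_vertex_angle\<close> below identifies it with the angle between
  the two sides issuing from a vertex.
\<close>

definition opp_angle :: "real \<Rightarrow> real \<Rightarrow> real \<Rightarrow> real" where
  "opp_angle a b c = arccos ((b\<^sup>2 + c\<^sup>2 - a\<^sup>2) / (2 * b * c))"

definition largest_angle :: "real \<Rightarrow> real \<Rightarrow> real \<Rightarrow> real" where
  "largest_angle a b c = Max {opp_angle a b c, opp_angle b c a, opp_angle c a b}"

definition makes_acute_triangle :: "real \<Rightarrow> real \<Rightarrow> real \<Rightarrow> bool" where
  "makes_acute_triangle a b c \<longleftrightarrow> makes_triangle a b c \<and> largest_angle a b c < pi / 2"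

definition makes_right_triangle :: "real \<Rightarrow> real \<Rightarrow> real \<Rightarrow> bool" where
  "makes_right_triangle a b c \<longleftrightarrow> makes_triangle a b c \<and> largest_angle a b c = pi / 2"

definition makes_obtuse_triangle :: "real \<Rightarrow> real \<Rightarrow> real \<Rightarrow> bool" where
  "makes_obtuse_triangle a b c \<longleftrightarrow> makes_triangle a b c \<and> largest_angle a b c > pi / 2"

lemma opp_angle_eq_vertex_angle:
  fixes A B C :: "'a :: real_inner"
  shows "opp_angle (dist B C) (dist C A) (dist A B) =
         arccos (((B - A) \<bullet> (C - A)) / (norm (B - A) * norm (C - A)))"
proof -
  have "(dist B C)\<^sup>2 = (norm ((B - A) - (C - A)))\<^sup>2"
    by (simp add: dist_norm)
  also have "\<dots> = (norm (B - A))\<^sup>2 + (norm (C - A))\<^sup>2 - 2 * ((B - A) \<bullet> (C - A))"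
    by (simp only: power2_norm_eq_inner inner_diff_left inner_diff_right inner_commute) simp
  finally have "(dist C A)\<^sup>2 + (dist A B)\<^sup>2 - (dist B C)\<^sup>2 = 2 * ((B - A) \<bullet> (C - A))"
    by (simp add: dist_norm norm_minus_commute)
  then show ?thesis
    by (simp add: opp_angle_def dist_norm norm_minus_commute mult.commute)
qed

lemma xphase_le: "xphase z \<sigma> \<le> 4 * norm z"
proof -
  have "xphase z \<sigma> \<le> (cmod (z $ 1) + cmod (z $ 4)) + (cmod (z $ 2) + cmod (z $ 3))"
    unfolding xphase_def
    by (intro add_mono order.trans[OF norm_triangle_ineq]) (simp_all add: norm_mult)
  also have "\<dots> \<le> 4 * norm z"
    using Finite_Cartesian_Product.norm_nth_le[of z 1] Finite_Cartesian_Product.norm_nth_le[of z 2]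
      Finite_Cartesian_Product.norm_nth_le[of z 3] Finite_Cartesian_Product.norm_nth_le[of z 4]
    by linarith
  finally show ?thesis .
qed

lemma bdd_above_xphase: "bdd_above (range (xphase z))"
  using xphase_le by (auto simp: bdd_above_def)

lemma xphase_le_xnorm: "xphase z \<sigma> \<le> xnorm z"
  unfolding xnorm_def by (rule cSUP_upper[OF _ bdd_above_xphase]) simp

lemma xnorm_attained: "\<exists>\<sigma>. xnorm z = xphase z \<sigma>"
proof -
  have "continuous_on {0..2 * pi} (xphase z)"
    unfolding xphase_def by (intro continuous_intros)
  then obtain \<sigma>0 where s0: "\<And>\<sigma>. \<sigma> \<in> {0..2 * pi} \<Longrightarrow> xphase z \<sigma> \<le> xphase z \<sigma>0"
    using continuous_attains_sup[of "{0..2 * pi}" "xphase z"]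
    by (metis atLeastatMost_empty_iff compact_Icc pi_ge_zero mult_nonneg_nonneg zero_le_numeral)
  have "xphase z \<sigma> \<le> xphase z \<sigma>0" for \<sigma>
  proof -
    obtain t where t: "0 \<le> t" "t < 2 * pi" and eq: "exp (\<i> * of_real \<sigma>) = exp (\<i> * of_real t)"
    proof -
      have n: "cmod (exp (\<i> * of_real \<sigma>)) = 1" by simp
      have "exp (\<i> * of_real \<sigma>) = exp (\<i> * of_real (Arg2pi (exp (\<i> * of_real \<sigma>))))"
        using Arg2pi_eq[of "exp (\<i> * of_real \<sigma>)"] n by simp
      then show ?thesis using that Arg2pi_ge_0 Arg2pi_lt_2pi by blast
    qed
    have "xphase z \<sigma> = xphase z t" by (simp add: xphase_def eq)
    with s0[of t] t show ?thesis by simp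
  qed
  then have "xnorm z = xphase z \<sigma>0"
    unfolding xnorm_def by (intro cSup_eq_maximum) auto
  then show ?thesis ..
qed

lemma xnorm_add: "xnorm (z + w) \<le> xnorm z + xnorm w"
proof -
  have "xphase (z + w) \<sigma> \<le> xnorm z + xnorm w" for \<sigma>
  proof -
    have a: "cmod ((z + w) $ i * u + cnj ((z + w) $ j)) \<le>
        cmod (z $ i * u + cnj (z $ j)) + cmod (w $ i * u + cnj (w $ j))" for i j u
      using norm_triangle_ineq[of "z $ i * u + cnj (z $ j)" "w $ i * u + cnj (w $ j)"]
      by (simp add: algebra_simps)
    have "xphase (z + w) \<sigma> \<le> xphase z \<sigma> + xphase w \<sigma>"
      unfolding xphase_def
      using a[of 1 "exp (\<i> * of_real \<sigma>)" 4] a[of 2 "exp (\<i> * of_real \<sigma>)" 3] by linarith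
    then show ?thesis using xphase_le_xnorm[of z \<sigma>] xphase_le_xnorm[of w \<sigma>] by linarith
  qed
  then show ?thesis unfolding xnorm_def[of "z + w"] by (intro cSUP_least) auto
qed

lemma xnorm_le: "xnorm z \<le> 4 * norm z"
  unfolding xnorm_def by (intro cSUP_least xphase_le) simp

lemma continuous_on_xnorm: "continuous_on S xnorm"
proof -
  have "\<bar>xnorm z - xnorm w\<bar> \<le> 4 * dist z w" for z w
    using xnorm_add[of "z - w" w] xnorm_add[of "w - z" z] xnorm_le[of "z - w"] xnorm_le[of "w - z"]
    by (simp add: dist_norm norm_minus_commute)
  then have "4-lipschitz_on S xnorm"
    by (intro lipschitz_onI) (auto simp: dist_real_def)
  then show ?thesis by (rule lipschitz_on_continuous_on)
qed

lemma norm_phase_align: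
  fixes a b :: complex
  shows "\<exists>\<sigma>. cmod (a * exp (\<i> * of_real \<sigma>) + b) = cmod a + cmod b"
proof -
  define \<sigma> where "\<sigma> = Arg b - Arg a"
  have A: "a = of_real (cmod a) * exp (\<i> * of_real (Arg a))"
    by (cases "a = 0") (use Arg_eq[of a] in auto)
  have B: "b = of_real (cmod b) * exp (\<i> * of_real (Arg b))"
    by (cases "b = 0") (use Arg_eq[of b] in auto)
  have "exp (\<i> * of_real (Arg a)) * exp (\<i> * of_real \<sigma>) = exp (\<i> * of_real (Arg b))"
    by (simp add: \<sigma>_def flip: exp_add) (simp add: algebra_simps)
  then have "a * exp (\<i> * of_real \<sigma>) = of_real (cmod a) * exp (\<i> * of_real (Arg b))"
    by (subst A) (simp add: mult.assoc)
  then have "a * exp (\<i> * of_real \<sigma>) + b =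
      of_real (cmod a + cmod b) * exp (\<i> * of_real (Arg b))"
    using B by (simp add: algebra_simps)
  then have "cmod (a * exp (\<i> * of_real \<sigma>) + b) = cmod a + cmod b"
    by (simp add: norm_mult del: of_real_add)
  then show ?thesis ..
qed

lemma cmod_add_le_xnorm:
  "cmod (z $ 1) + cmod (z $ 4) \<le> xnorm z" "cmod (z $ 2) + cmod (z $ 3) \<le> xnorm z"
proof -
  obtain s where s: "cmod (z $ 1 * exp (\<i> * of_real s) + cnj (z $ 4)) = cmod (z $ 1) + cmod (z $ 4)"
    using norm_phase_align[of "z $ 1" "cnj (z $ 4)"] by auto
  obtain t where t: "cmod (z $ 2 * exp (\<i> * of_real t) + cnj (z $ 3)) = cmod (z $ 2) + cmod (z $ 3)"
    using norm_phase_align[of "z $ 2" "cnj (z $ 3)"] by auto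
  show "cmod (z $ 1) + cmod (z $ 4) \<le> xnorm z"
    using xphase_le_xnorm[of z s] s norm_ge_zero unfolding xphase_def
    by (smt (verit))
  show "cmod (z $ 2) + cmod (z $ 3) \<le> xnorm z"
    using xphase_le_xnorm[of z t] t norm_ge_zero unfolding xphase_def
    by (smt (verit))
qed

lemma norm_le_xnorm: "norm z \<le> 2 * xnorm z"
proof -
  have "norm z \<le> (\<Sum>i\<in>UNIV. cmod (z $ i))"
    unfolding norm_vec_def by (rule L2_set_le_sum) simp
  then show ?thesis using cmod_add_le_xnorm[of z] by (simp add: sum_4)
qed

lemma dual_xnorm_attained: "\<exists>z. xnorm z = 1 \<and> dual_xnorm c = cmod (pairing c z)"
proof -
  let ?S = "{z. xnorm z = 1}"
  have "closed ?S"
    using continuous_closed_preimage_constant[of UNIV xnorm 1] continuous_on_xnorm by simp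
  moreover have "bounded ?S"
    unfolding bounded_iff using norm_le_xnorm by (metis mem_Collect_eq mult.right_neutral)
  ultimately have "compact ?S" by (simp add: compact_eq_bounded_closed)
  moreover have "axis 1 1 \<in> ?S"
    by (simp add: xnorm_def xphase_def axis_def)
  moreover have "continuous_on ?S (\<lambda>z. cmod (pairing c z))"
    unfolding pairing_def by (intro continuous_intros)
  ultimately obtain z where z: "z \<in> ?S" "\<And>w. w \<in> ?S \<Longrightarrow> cmod (pairing c w) \<le> cmod (pairing c z)"
    using continuous_attains_sup[of ?S "\<lambda>z. cmod (pairing c z)"] by blast
  then have "dual_xnorm c = cmod (pairing c z)"
    unfolding dual_xnorm_def by (intro cSup_eq_maximum) auto
  with z show ?thesis by auto
qed

end

theory Submission
  imports Defs
begin

text \<open>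
  Since \<open>|z\<^sub>1 u + cnj z\<^sub>4| + |z\<^sub>2 u + cnj z\<^sub>3|\<close> is the largest value of
  \<open>Re (\<Sum> p\<^sub>i z\<^sub>i)\<close> over the unimodular \<open>p\<close> with \<open>p\<^sub>1 p\<^sub>4 = p\<^sub>2 p\<^sub>3 = u\<close>, the dual unit ball is
  the convex hull of the unimodular \<open>p\<close> with \<open>p\<^sub>1 p\<^sub>4 = p\<^sub>2 p\<^sub>3\<close>.  Averaging two such points shows
  that \<open>(cos \<theta>\<^sub>1, cos \<theta>\<^sub>2, cos \<theta>\<^sub>3, 0)\<close> lies in this ball whenever
  \<open>\<theta>\<^sub>1 + \<theta>\<^sub>2 + \<theta>\<^sub>3 = \<pi>/2\<close>.  With \<open>\<theta>\<^sub>i = \<pi>/2 - \<alpha>\<^sub>i\<close> for the angles \<open>\<alpha>\<^sub>i\<close> of a triangle this bounds the dual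
  norm by the diameter of the circumscribed circle; with \<open>\<theta>\<^sub>1 = 0\<close> it gives \<open>(1, x, y, 0)\<close> for
  \<open>x\<^sup>2 + y\<^sup>2 = 1\<close>, hence for \<open>x\<^sup>2 + y\<^sup>2 \<le> 1\<close>, which covers everything but acute triangles.
  In the acute case the bound is attained at a multiple of
  \<open>(1 / cos \<alpha>\<^sub>1, 1 / cos \<alpha>\<^sub>2, 1 / cos \<alpha>\<^sub>3, - 1)\<close>: as a function of \<open>cos \<sigma>\<close>, the two summands of its
  phase function are square roots of linear functions, and their tangents at \<open>cos \<sigma> = cos \<alpha>\<^sub>1\<close> have
  opposite slopes.
\<close>

section \<open>Unimodular vectors and points of the dual unit ball\<close>

lemma unit_mult_cnj: "cmod x = 1 \<Longrightarrow> x * cnj x = 1"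
  by (simp flip: complex_norm_square)

lemma Re_pairing_le_xnorm:
  fixes p z :: "complex ^ 4"
  assumes p: "\<And>i. cmod (p $ i) = 1" and eq: "p $ 1 * p $ 4 = p $ 2 * p $ 3"
  shows "Re (pairing p z) \<le> xnorm z"
proof -
  define u where "u = p $ 1 * p $ 4"
  have "cmod u = 1" by (simp add: u_def norm_mult p)
  then obtain s where s: "u = exp (\<i> * of_real s)"
    by (metis complex_norm_eq_1_exp)
  \<comment> \<open>Conjugating \<open>y * b\<close> keeps the real part; multiplying by the
    unimodular \<open>y\<close> then produces the phase \<open>x * y\<close>.\<close>
  have *: "Re (x * a + y * b) \<le> cmod (a * (x * y) + cnj b)" if "cmod y = 1" for x y a b
  proof -
    have y: "y * cnj y = 1" using that by (rule unit_mult_cnj)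
    have "Re (x * a + y * b) = Re (x * a + cnj y * cnj b)" by simp
    also have "\<dots> \<le> cmod (x * a + cnj y * cnj b)" by (rule complex_Re_le_cmod)
    also have "\<dots> = cmod (y * (x * a + cnj y * cnj b))" using that by (simp add: norm_mult)
    also have "y * (x * a + cnj y * cnj b) = a * (x * y) + cnj b * (y * cnj y)"
      by (simp add: algebra_simps)
    finally show ?thesis by (simp add: y)
  qed
  have "Re (pairing p z) = Re (p $ 1 * z $ 1 + p $ 4 * z $ 4) + Re (p $ 2 * z $ 2 + p $ 3 * z $ 3)"
    by (simp add: pairing_def sum_4)
  also have "\<dots> \<le> xphase z s"
    unfolding xphase_def s[symmetric]
    using *[of "p $ 4" "p $ 1" "z $ 1" "z $ 4"] *[of "p $ 3" "p $ 2" "z $ 2" "z $ 3"] p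
    unfolding u_def by (subst (2) eq) (intro add_mono; simp)
  also have "\<dots> \<le> xnorm z" by (rule xphase_le_xnorm)
  finally show ?thesis .
qed

lemma cmod_eq_Re_rotate: "\<exists>e. cmod e = 1 \<and> cmod x = Re (e * x)"
proof (cases "x = 0")
  case False
  then have "cnj x * x = of_real (cmod x ^ 2)"
    by (simp add: complex_norm_square mult.commute del: of_real_power)
  with False have "cnj x / of_real (cmod x) * x = of_real (cmod x)"
    by (simp add: power2_eq_square)
  with False show ?thesis
    by (intro exI[of _ "cnj x / of_real (cmod x)"]) (simp add: norm_divide)
qed (auto intro: exI[of _ 1])

text \<open>A common rotation of \<open>p\<close> preserves the constraint, which is homogeneous, so
  the modulus reduces to a real part.\<close>

lemma cmod_pairing_le_xnorm:
  fixes p z :: "complex ^ 4"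
  assumes p: "\<And>i. cmod (p $ i) = 1" and eq: "p $ 1 * p $ 4 = p $ 2 * p $ 3"
  shows "cmod (pairing p z) \<le> xnorm z"
proof -
  obtain e where e: "cmod e = 1" "cmod (pairing p z) = Re (e * pairing p z)"
    using cmod_eq_Re_rotate by blast
  have "e * pairing p z = pairing (\<chi> i. e * p $ i) z"
    by (simp add: pairing_def sum_distrib_left mult.assoc)
  with e Re_pairing_le_xnorm[of "\<chi> i. e * p $ i" z] show ?thesis
    by (simp add: p norm_mult eq algebra_simps)
qed

text \<open>
  Moduli of the vectors with vanishing fourth entry in the dual unit ball; quantifying over the
  phases is harmless because the free fourth phase absorbs the constraint.
\<close>

definition dual_ball :: "real \<Rightarrow> real \<Rightarrow> real \<Rightarrow> bool" where
  "dual_ball a b d \<longleftrightarrow> (\<forall>e1 e2 e3 z. cmod e1 = 1 \<longrightarrow> cmod e2 = 1 \<longrightarrow> cmod e3 = 1 \<longrightarrow>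
     cmod (e1 * of_real a * z $ 1 + e2 * of_real b * z $ 2 + e3 * of_real d * z $ 3) \<le> xnorm z)"

lemma dual_ball_midpoint:
  assumes "dual_ball a b d" "dual_ball a' b' d'"
  shows "dual_ball ((a + a') / 2) ((b + b') / 2) ((d + d') / 2)"
  unfolding dual_ball_def
proof (intro allI impI)
  fix e1 e2 e3 :: complex and z :: "complex ^ 4"
  assume e: "cmod e1 = 1" "cmod e2 = 1" "cmod e3 = 1"
  let ?f = "\<lambda>a b d. e1 * of_real a * z $ 1 + e2 * of_real b * z $ 2 + e3 * of_real d * z $ 3"
  have "?f ((a + a') / 2) ((b + b') / 2) ((d + d') / 2) = (?f a b d + ?f a' b' d') / 2"
    by (simp add: field_simps)
  then have "cmod (?f ((a + a') / 2) ((b + b') / 2) ((d + d') / 2)) = cmod (?f a b d + ?f a' b' d') / 2"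
    by (simp only: norm_divide norm_numeral)
  moreover note norm_triangle_ineq[of "?f a b d" "?f a' b' d'"]
  moreover have "cmod (?f a b d) \<le> xnorm z" "cmod (?f a' b' d') \<le> xnorm z"
    using assms e unfolding dual_ball_def by blast+
  ultimately show "cmod (?f ((a + a') / 2) ((b + b') / 2) ((d + d') / 2)) \<le> xnorm z"
    by linarith
qed

lemma dual_ball_Re:
  assumes w: "cmod w1 = 1" "cmod w2 = 1" "cmod w3 = 1" and prod: "w1 * w2 * w3 = \<i>"
  shows "dual_ball (Re w1) (Re w2) (Re w3)"
  unfolding dual_ball_def
proof (intro allI impI)
  fix e1 e2 e3 :: complex and z :: "complex ^ 4"
  assume e: "cmod e1 = 1" "cmod e2 = 1" "cmod e3 = 1"
  \<comment> \<open>Chosen so that \<open>e1 * e4 = e2 * e3\<close>.\<close>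
  define e4 where "e4 = cnj e1 * e2 * e3"
  define P :: "complex \<Rightarrow> complex \<Rightarrow> complex \<Rightarrow> complex \<Rightarrow> complex ^ 4" where
    "P = (\<lambda>a b c d. \<chi> i. if i = 1 then a else if i = 2 then b else if i = 3 then c else d)"
  have P: "P a b c d $ 1 = a" "P a b c d $ 2 = b" "P a b c d $ 3 = c" "P a b c d $ 4 = d" for a b c d
    by (simp_all add: P_def)
  \<comment> \<open>In the average of \<open>p\<close> and \<open>q\<close> the fourth entries
    cancel and the others become real parts; the conjugates are placed so that both constraints
    follow from \<open>prod\<close>.\<close>
  define p where "p = P (e1 * cnj w1) (e2 * w2) (e3 * w3) (e4 * \<i>)"
  define q where "q = P (e1 * w1) (e2 * cnj w2) (e3 * cnj w3) (e4 * (- \<i>))"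
  have "p $ 1 * p $ 4 = (e1 * cnj e1) * e2 * e3 * (w1 * cnj w1) * w2 * w3"
    by (simp add: p_def P e4_def flip: prod)
  also have "\<dots> = p $ 2 * p $ 3" using unit_mult_cnj e w by (simp add: p_def P)
  finally have p: "p $ 1 * p $ 4 = p $ 2 * p $ 3" .
  have "- \<i> = cnj w1 * cnj w2 * cnj w3" using arg_cong[OF prod, of cnj] by simp
  then have "q $ 1 * q $ 4 = (e1 * cnj e1) * e2 * e3 * (w1 * cnj w1) * cnj w2 * cnj w3"
    by (simp only: q_def P e4_def mult_ac)
  also have "\<dots> = q $ 2 * q $ 3" using unit_mult_cnj e w by (simp add: q_def P)
  finally have q: "q $ 1 * q $ 4 = q $ 2 * q $ 3" .
  have Re: "of_real (Re x) = (x + cnj x) / 2" for x by (simp add: complex_add_cnj)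
  have "e1 * of_real (Re w1) * z $ 1 + e2 * of_real (Re w2) * z $ 2 + e3 * of_real (Re w3) * z $ 3
      = (pairing p z + pairing q z) / 2" (is "?lhs = _")
    unfolding Re by (simp add: pairing_def sum_4 p_def q_def P field_simps)
  then have "cmod ?lhs = cmod (pairing p z + pairing q z) / 2"
    by (simp only: norm_divide norm_numeral)
  moreover have pq: "cmod (p $ i) = 1" "cmod (q $ i) = 1" for i
    using e w by (simp_all add: p_def q_def P_def e4_def norm_mult)
  ultimately show "cmod (e1 * of_real (Re w1) * z $ 1 + e2 * of_real (Re w2) * z $ 2
      + e3 * of_real (Re w3) * z $ 3) \<le> xnorm z"
    using cmod_pairing_le_xnorm[OF pq(1) p, of z] cmod_pairing_le_xnorm[OF pq(2) q, of z]
      norm_triangle_ineq[of "pairing p z" "pairing q z"] by linarith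
qed

text \<open>A point of the disc is the midpoint of the chord perpendicular to its radius, whose ends
  have the angles \<open>\<tau> + arccos r\<close> and \<open>\<tau> - arccos r\<close>.\<close>

lemma unit_disc_eq_midpoint:
  fixes x y :: real
  assumes "x\<^sup>2 + y\<^sup>2 \<le> 1"
  obtains \<phi> \<psi> where "x = (cos \<phi> + cos \<psi>) / 2" "y = (sin \<phi> + sin \<psi>) / 2"
proof -
  define \<tau> where "\<tau> = Arg (Complex x y)"
  define r where "r = cmod (Complex x y)"
  have r: "0 \<le> r" "r \<le> 1" using assms by (simp_all add: r_def cmod_def)
  have "Complex x y = of_real r * exp (\<i> * of_real \<tau>)"
    by (cases "Complex x y = 0") (use Arg_eq[of "Complex x y"] in \<open>auto simp: r_def \<tau>_def\<close>)
  then have "x = r * cos \<tau>" "y = r * sin \<tau>"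
    by (simp_all add: complex_eq_iff Re_exp Im_exp)
  moreover have "cos (arccos r) = r" using r by simp
  ultimately have "x = (cos (\<tau> + arccos r) + cos (\<tau> - arccos r)) / 2"
    "y = (sin (\<tau> + arccos r) + sin (\<tau> - arccos r)) / 2"
    by (simp_all add: cos_add cos_diff sin_add sin_diff)
  then show ?thesis by (rule that)
qed

text \<open>The factors 1, \<open>cis t\<close> and \<open>\<i> * cis (- t)\<close> in
  \<open>dual_ball_Re\<close> give the circle, since the last has real part \<open>sin t\<close>;
  midpoints fill the disc.\<close>

lemma dual_ball_disc:
  assumes "x\<^sup>2 + y\<^sup>2 \<le> 1"
  shows "dual_ball 1 x y" "dual_ball x 1 y" "dual_ball x y 1"
proof -
  have cis: "cis t * (\<i> * cis (- t)) = \<i>" for t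
    by (metis cis_mult cis_zero add.right_inverse mult.left_commute mult.right_neutral)
  have "dual_ball 1 (cos t) (sin t)" "dual_ball (cos t) 1 (sin t)" "dual_ball (cos t) (sin t) 1" for t
    using dual_ball_Re[of 1 "cis t" "\<i> * cis (- t)"] dual_ball_Re[of "cis t" 1 "\<i> * cis (- t)"]
      dual_ball_Re[of "cis t" "\<i> * cis (- t)" 1] cis
    by (simp_all add: norm_mult)
  moreover obtain \<phi> \<psi> where "x = (cos \<phi> + cos \<psi>) / 2" "y = (sin \<phi> + sin \<psi>) / 2"
    using unit_disc_eq_midpoint[OF assms] .
  ultimately show "dual_ball 1 x y" "dual_ball x 1 y" "dual_ball x y 1"
    using dual_ball_midpoint[of 1 _ _ 1] dual_ball_midpoint[of _ 1 _ _ 1]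
      dual_ball_midpoint[of _ _ 1 _ _ 1] by (metis one_add_one divide_self zero_neq_numeral)+
qed

text \<open>By Heron's formula \<open>S\<close> is four times the area, so
  \<open>S / (2 * a * b * d)\<close> is the reciprocal of the circumdiameter and the three numbers
  are the sines of the angles.\<close>

lemma dual_ball_triangle:
  fixes a b d S :: real
  assumes pos: "a > 0" "b > 0" "d > 0" and "S > 0"
    and S: "S\<^sup>2 = (a + b + d) * (- a + b + d) * (a - b + d) * (a + b - d)"
  shows "dual_ball (a * (S / (2 * a * b * d))) (b * (S / (2 * a * b * d))) (d * (S / (2 * a * b * d)))"
proof -
  \<comment> \<open>At an angle \<alpha> of the triangle this is
    \<open>\<i> * cis (- \<alpha>)\<close>; the product is \<open>\<i>\<close> because the angles
    sum to \<open>pi\<close>.\<close>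
  define w where "w = (\<lambda>A g. Complex (S / g) (A / g))"
  let ?A = "b\<^sup>2 + d\<^sup>2 - a\<^sup>2" and ?B = "a\<^sup>2 + d\<^sup>2 - b\<^sup>2" and ?D = "a\<^sup>2 + b\<^sup>2 - d\<^sup>2"
  have unit: "cmod (w A g) = 1" if "S\<^sup>2 + A\<^sup>2 = g\<^sup>2" "g \<noteq> 0" for A g
  proof -
    have "(S / g)\<^sup>2 + (A / g)\<^sup>2 = 1" using that by (simp add: power_divide flip: add_divide_distrib)
    then show ?thesis by (simp add: w_def cmod_def)
  qed
  have sq: "S\<^sup>2 + ?A\<^sup>2 = (2 * b * d)\<^sup>2" "S\<^sup>2 + ?B\<^sup>2 = (2 * a * d)\<^sup>2" "S\<^sup>2 + ?D\<^sup>2 = (2 * a * b)\<^sup>2"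
    unfolding S by algebra+
  \<comment> \<open>Divided by \<open>S\<^sup>2\<close>, the pairwise products of the three
    cotangents sum to 1; this makes the real part below vanish.\<close>
  have sum: "S\<^sup>2 = ?A * ?B + ?B * ?D + ?D * ?A" unfolding S by algebra
  have "Complex S ?A * Complex S ?B * Complex S ?D
      = Complex (S * (S\<^sup>2 - (?A * ?B + ?B * ?D + ?D * ?A))) (S\<^sup>2 * (?A + ?B + ?D) - ?A * ?B * ?D)"
    by (simp add: complex_eq_iff algebra_simps power2_eq_square)
  also have "\<dots> = Complex 0 ((2 * b * d) * (2 * a * d) * (2 * a * b))"
  proof -
    have "S\<^sup>2 * (?A + ?B + ?D) - ?A * ?B * ?D = (2 * b * d) * (2 * a * d) * (2 * a * b)"
      unfolding sum by algebra
    then show ?thesis using sum by simp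
  qed
  finally have prod: "Complex S ?A * Complex S ?B * Complex S ?D =
    of_real (2 * b * d) * of_real (2 * a * d) * of_real (2 * a * b) * \<i>"
    by (simp add: complex_eq_iff)
  have w: "w A g = Complex S A / of_real g" for A g by (simp add: w_def complex_eq_iff)
  have "w ?A (2 * b * d) * w ?B (2 * a * d) * w ?D (2 * a * b) =
     (Complex S ?A * Complex S ?B * Complex S ?D) / (of_real (2 * b * d) * of_real (2 * a * d) * of_real (2 * a * b))"
    unfolding w by simp
  also have "\<dots> = \<i>" unfolding prod using pos by simp
  finally have "w ?A (2 * b * d) * w ?B (2 * a * d) * w ?D (2 * a * b) = \<i>" .
  from dual_ball_Re[OF unit[OF sq(1)] unit[OF sq(2)] unit[OF sq(3)] this] pos
  have "dual_ball (S / (2 * b * d)) (S / (2 * a * d)) (S / (2 * a * b))"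
    by (simp add: w_def)
  then show ?thesis using pos by (simp add: mult.assoc)
qed

section \<open>Duality between the two norms\<close>

lemma dual_xnorm_le:
  assumes "\<And>z. cmod (pairing c z) \<le> r * xnorm z"
  shows "dual_xnorm c \<le> r"
  using dual_xnorm_attained[of c] assms by (metis mult.right_neutral)

lemma dual_xnorm_le_if_dual_ball:
  assumes "r > 0" "dual_ball (cmod (c $ 1) / r) (cmod (c $ 2) / r) (cmod (c $ 3) / r)" "c $ 4 = 0"
  shows "dual_xnorm c \<le> r"
proof (rule dual_xnorm_le)
  fix z
  have ph: "\<exists>e. cmod e = 1 \<and> e * of_real (cmod x) = x" for x
    by (cases "x = 0") (auto intro: exI[of _ 1] exI[of _ "sgn x"] simp: sgn_eq norm_divide)
  then obtain e1 e2 e3 where e: "cmod e1 = 1" "cmod e2 = 1" "cmod e3 = 1"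
    "e1 * of_real (cmod (c $ 1)) = c $ 1" "e2 * of_real (cmod (c $ 2)) = c $ 2"
    "e3 * of_real (cmod (c $ 3)) = c $ 3" by metis
  have "cmod (e1 * of_real (cmod (c $ 1) / r) * z $ 1 + e2 * of_real (cmod (c $ 2) / r) * z $ 2
    + e3 * of_real (cmod (c $ 3) / r) * z $ 3) \<le> xnorm z"
    using assms(2) e(1-3) unfolding dual_ball_def by blast
  also have "e1 * of_real (cmod (c $ 1) / r) * z $ 1 + e2 * of_real (cmod (c $ 2) / r) * z $ 2
    + e3 * of_real (cmod (c $ 3) / r) * z $ 3 = pairing c z / of_real r"
    using e(4-6) assms(3) by (simp add: pairing_def sum_4 add_divide_distrib)
  finally show "cmod (pairing c z) \<le> r * xnorm z"
    using \<open>r > 0\<close> by (simp add: norm_divide field_simps)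
qed

lemma xnorm_scaleR:
  assumes "t > 0" shows "xnorm (t *\<^sub>R z) = t * xnorm z"
proof -
  have "xphase (t *\<^sub>R z) s = t * xphase z s" for s
  proof -
    have "cmod ((t *\<^sub>R z) $ i * u + cnj ((t *\<^sub>R z) $ j)) = t * cmod (z $ i * u + cnj (z $ j))" for i j u
    proof -
      have "(t *\<^sub>R z) $ i * u + cnj ((t *\<^sub>R z) $ j) = t *\<^sub>R (z $ i * u + cnj (z $ j))"
        by (simp add: scaleR_add_right)
      then show ?thesis using assms by (simp only: norm_scaleR abs_of_pos)
    qed
    then show ?thesis by (simp only: xphase_def distrib_left)
  qed
  moreover have "(SUP s. t * xphase z s) = t * (SUP s. xphase z s)"
    using xnorm_attained[of z] xphase_le_xnorm[of z] assms unfolding xnorm_def[symmetric]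
    by (intro cSup_eq_maximum) (auto intro: mult_left_mono)
  ultimately show ?thesis by (simp add: xnorm_def)
qed

text \<open>Homogeneity reduces a nonzero \<open>z\<close> to the unit sphere, where boundedness
  makes the supremum an upper bound.\<close>

lemma cmod_pairing_le_dual:
  "cmod (pairing c z) \<le> dual_xnorm c * xnorm z"
proof (cases "z = 0")
  case True
  then show ?thesis by (simp add: pairing_def xnorm_def xphase_def)
next
  case False
  then have x: "xnorm z > 0" using norm_le_xnorm[of z] by (metis zero_less_norm_iff mult_pos_pos
     mult_less_cancel_left_pos less_le_trans mult_zero_right zero_less_numeral)
  define y where "y = (1 / xnorm z) *\<^sub>R z"
  have "xnorm y = 1" using x by (simp add: y_def xnorm_scaleR)
  have bdd: "bdd_above ((\<lambda>z. cmod (pairing c z)) ` {z. xnorm z = 1})"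
  proof (rule bdd_aboveI2)
    fix z assume z: "z \<in> {z. xnorm z = 1}"
    have "cmod (z $ i) \<le> 2" for i
      using z norm_le_xnorm[of z] Finite_Cartesian_Product.norm_nth_le[of z i] by simp
    then have "cmod (c $ i * z $ i) \<le> cmod (c $ i) * 2" for i
      unfolding norm_mult by (rule mult_left_mono) simp
    then show "cmod (pairing c z) \<le> (\<Sum>i\<in>UNIV. cmod (c $ i) * 2)"
      unfolding pairing_def by (rule sum_norm_le)
  qed
  have "cmod (pairing c y) \<le> dual_xnorm c"
    unfolding dual_xnorm_def by (rule cSUP_upper[OF _ bdd]) (simp add: \<open>xnorm y = 1\<close>)
  moreover have "cmod (pairing c y) = cmod (pairing c z) / xnorm z"
  proof -
    have "pairing c y = (1 / xnorm z) *\<^sub>R pairing c z"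
      by (simp add: y_def pairing_def scaleR_sum_right)
    then show ?thesis using x by simp
  qed
  ultimately show ?thesis using x by (simp add: field_simps)
qed

lemma xnorm_axis: "xnorm (axis i 1) = 1"
proof -
  have "i = 1 \<or> i = 2 \<or> i = 3 \<or> i = 4" using exhaust_4 by blast
  then have "xphase (axis i 1) s = 1" for s
    by (auto simp: xphase_def axis_def)
  then show ?thesis by (simp add: xnorm_def)
qed

lemma linfnorm_le_dual_xnorm: "linfnorm c \<le> dual_xnorm c"
proof -
  have "cmod (c $ i) \<le> dual_xnorm c" for i
  proof -
    have "pairing c (axis i 1) = c $ i"
      by (simp add: pairing_def axis_def if_distrib sum.delta cong: if_cong)
    then show ?thesis using cmod_pairing_le_dual[of c "axis i 1"] by (simp add: xnorm_axis)
  qed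
  then show ?thesis by (simp add: linfnorm_def)
qed

lemma cmod_le_linfnorm: "cmod (c $ i) \<le> linfnorm c"
  by (simp add: linfnorm_def)

section \<open>The non-acute case\<close>

text \<open>Division by the modulus with the dominating square puts the other two in the unit disc,
  so \<open>dual_ball_disc\<close> applies; the zero vector is treated separately.\<close>

lemma dual_xnorm_eq_linfnorm:
  fixes c :: "complex ^ 4"
  defines "a \<equiv> cmod (c $ 1)" and "b \<equiv> cmod (c $ 2)" and "d \<equiv> cmod (c $ 3)"
  assumes "c $ 4 = 0" "b\<^sup>2 + d\<^sup>2 \<le> a\<^sup>2 \<or> a\<^sup>2 + d\<^sup>2 \<le> b\<^sup>2 \<or> a\<^sup>2 + b\<^sup>2 \<le> d\<^sup>2"
  shows "dual_xnorm c = linfnorm c"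
proof (rule antisym)
  show "dual_xnorm c \<le> linfnorm c"
  proof (cases "c = 0")
    case True
    have "dual_xnorm c \<le> 0" by (rule dual_xnorm_le) (simp add: True pairing_def)
    then show ?thesis using cmod_le_linfnorm[of c 1] norm_ge_zero[of "c $ 1"] by linarith
  next
    case False
    then have "a \<noteq> 0 \<or> b \<noteq> 0 \<or> d \<noteq> 0"
      using \<open>c $ 4 = 0\<close> by (auto simp: a_def b_def d_def vec_eq_iff forall_4)
    have disc: "r > 0 \<and> (x / r)\<^sup>2 + (y / r)\<^sup>2 \<le> 1"
      if "x\<^sup>2 + y\<^sup>2 \<le> r\<^sup>2" "r \<ge> 0" "r \<noteq> 0 \<or> x \<noteq> 0 \<or> y \<noteq> 0" for x y r :: real
    proof -
      have "r \<noteq> 0" using that by (auto simp: sum_power2_le_zero_iff)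
      then show ?thesis using that by (simp add: power_divide flip: add_divide_distrib)
    qed
    have nn: "a \<ge> 0" "b \<ge> 0" "d \<ge> 0" by (simp_all add: a_def b_def d_def)
    consider "b\<^sup>2 + d\<^sup>2 \<le> a\<^sup>2" | "a\<^sup>2 + d\<^sup>2 \<le> b\<^sup>2" | "a\<^sup>2 + b\<^sup>2 \<le> d\<^sup>2" using assms by blast
    then have "dual_xnorm c \<le> a \<or> dual_xnorm c \<le> b \<or> dual_xnorm c \<le> d"
    proof cases
      case 1
      then have "a > 0 \<and> (b / a)\<^sup>2 + (d / a)\<^sup>2 \<le> 1" using disc nn \<open>a \<noteq> 0 \<or> _\<close> by blast
      then show ?thesis using dual_xnorm_le_if_dual_ball[of a c] dual_ball_disc(1)[of "b / a" "d / a"]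
          \<open>c $ 4 = 0\<close> by (simp add: a_def b_def d_def)
    next
      case 2
      then have "b > 0 \<and> (a / b)\<^sup>2 + (d / b)\<^sup>2 \<le> 1" using disc nn \<open>a \<noteq> 0 \<or> _\<close> by blast
      then show ?thesis using dual_xnorm_le_if_dual_ball[of b c] dual_ball_disc(2)[of "a / b" "d / b"]
          \<open>c $ 4 = 0\<close> by (simp add: a_def b_def d_def)
    next
      case 3
      then have "d > 0 \<and> (a / d)\<^sup>2 + (b / d)\<^sup>2 \<le> 1" using disc nn \<open>a \<noteq> 0 \<or> _\<close> by blast
      then show ?thesis using dual_xnorm_le_if_dual_ball[of d c] dual_ball_disc(3)[of "a / d" "b / d"]
          \<open>c $ 4 = 0\<close> by (simp add: a_def b_def d_def)
    qed
    then show ?thesis using cmod_le_linfnorm[of c] unfolding a_def b_def d_def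
      by (meson order_trans)
  qed
qed (rule linfnorm_le_dual_xnorm)

section \<open>The acute case\<close>

lemma cmod_unit_mult_add_sq:
  assumes "cmod u = 1"
  shows "(cmod (u * of_real x + of_real y))\<^sup>2 = x\<^sup>2 + y\<^sup>2 + 2 * x * y * Re u"
proof -
  have "(Re u)\<^sup>2 + (Im u)\<^sup>2 = 1" using assms by (simp add: cmod_def)
  moreover have "(cmod (u * of_real x + of_real y))\<^sup>2 = x\<^sup>2 * ((Re u)\<^sup>2 + (Im u)\<^sup>2) + y\<^sup>2 + 2 * x * y * Re u"
    by (simp add: cmod_power2) algebra
  ultimately show ?thesis by simp
qed

text \<open>The square root is concave, so it lies below its tangent at
  \<open>m\<^sup>2\<close>.\<close>

lemma le_of_tangent:
  fixes n m :: real
  assumes "m > 0" "n\<^sup>2 = p"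
  shows "n \<le> (p + m\<^sup>2) / (2 * m)"
proof -
  have "2 * m * n \<le> n\<^sup>2 + m\<^sup>2" using zero_le_power2[of "n - m"] by (simp add: power2_diff algebra_simps)
  then show ?thesis using assms by (simp add: field_simps)
qed

text \<open>
  In terms of a triangle with sides \<open>a, b, d\<close> and area \<open>S / 4\<close>: \<open>A = b\<^sup>2 + d\<^sup>2 - a\<^sup>2\<close> (cyclically for
  \<open>B\<close> and \<open>D\<close>), \<open>g = 2bd\<close>, \<open>h = 2ad\<close>, \<open>l = 2ab\<close>, so that \<open>A / g\<close> and \<open>S / A\<close> are the cosine and
  the tangent of the angle opposite to \<open>a\<close>.
\<close>

lemma extremal_xphase_le:
  fixes A B D S g h l :: real
  assumes pos: "A > 0" "B > 0" "D > 0" "S > 0"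
    and S: "S\<^sup>2 = A * B + B * D + D * A"
    and g: "g\<^sup>2 = S\<^sup>2 + A\<^sup>2" and h: "h\<^sup>2 = S\<^sup>2 + B\<^sup>2" and l: "l\<^sup>2 = S\<^sup>2 + D\<^sup>2"
    and hl: "h * l = g * (B + D)" and u: "cmod u = 1"
  shows "cmod (u * of_real (g / A) + of_real (- 1)) + cmod (u * of_real (h / B) + of_real (l / D))
    \<le> S ^ 3 / (A * B * D)"
proof -
  define x where "x = Re u"
  \<comment> \<open>The point of tangency is \<open>Re u = A / g\<close>, where this modulus equals
    \<open>S / A\<close>.\<close>
  have "cmod (u * of_real (g / A) + of_real (- 1)) \<le>
      ((g / A)\<^sup>2 + (- 1)\<^sup>2 + 2 * (g / A) * (- 1) * x + (S / A)\<^sup>2) / (2 * (S / A))"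
    unfolding x_def
    by (rule le_of_tangent[OF _ cmod_unit_mult_add_sq[OF u]]) (use pos in simp)
  also have "\<dots> = S / A + A / S - g * x / S"
    unfolding power_divide g using pos by (simp add: field_simps power2_eq_square)
  finally have 1: "cmod (u * of_real (g / A) + of_real (- 1)) \<le> S / A + A / S - g * x / S" .
  \<comment> \<open>At the same \<open>Re u\<close> the second modulus equals
    \<open>S / B + S / D\<close>.\<close>
  have m: "S / B + S / D > 0" using pos by (simp add: add_pos_pos)
  have "cmod (u * of_real (h / B) + of_real (l / D)) \<le>
      ((h / B)\<^sup>2 + (l / D)\<^sup>2 + 2 * (h / B) * (l / D) * x + (S / B + S / D)\<^sup>2) / (2 * (S / B + S / D))"
    unfolding x_def by (rule le_of_tangent[OF m]) (rule cmod_unit_mult_add_sq[OF u])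
  also have "\<dots> = S / B + S / D - A / S + g * x / S"
  proof -
    have q: "(h / B)\<^sup>2 + (l / D)\<^sup>2 + 2 * (h / B) * (l / D) * x
        = S\<^sup>2 / B\<^sup>2 + S\<^sup>2 / D\<^sup>2 + 2 + 2 * (g * (B + D)) * x / (B * D)"
      unfolding power_divide h l hl[symmetric] using pos by (simp add: field_simps power2_eq_square)
    have BD: "B * D = S\<^sup>2 - A * (B + D)" using S by (simp add: algebra_simps)
    have "(S / B + S / D) * (S / B + S / D - A / S + g * x / S) * 2
      = 2 * (S / B + S / D)\<^sup>2 + 2 * (B + D) * (g * x - A) / (B * D)"
      using pos by (simp add: field_simps power2_eq_square)
    also have "\<dots> = S\<^sup>2 / B\<^sup>2 + S\<^sup>2 / D\<^sup>2 + 2 * (S\<^sup>2 - A * (B + D)) / (B * D) + 2 * (g * (B + D)) * x / (B * D)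
         + (S / B + S / D)\<^sup>2"
      using pos by (simp add: field_simps power2_eq_square)
    also have "2 * (S\<^sup>2 - A * (B + D)) / (B * D) = 2"
      unfolding BD[symmetric] using pos by simp
    finally have "(S / B + S / D) * (S / B + S / D - A / S + g * x / S) * 2 =
        S\<^sup>2 / B\<^sup>2 + S\<^sup>2 / D\<^sup>2 + 2 + 2 * (g * (B + D)) * x / (B * D) + (S / B + S / D)\<^sup>2" .
    moreover have "n / (2 * M) = Y" if "M * Y * 2 = n" "M > 0" for n M Y :: real
      using that by auto
    ultimately show ?thesis unfolding q using m by blast
  qed
  finally have 2: "cmod (u * of_real (h / B) + of_real (l / D)) \<le> S / B + S / D - A / S + g * x / S" .
  \<comment> \<open>The tangents of the angles of a triangle have equal sum and product. The slopes
    \<open>- g / S\<close> and \<open>g / S\<close> cancel in the final sum.\<close>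
  have "S ^ 3 / (A * B * D) = S * S\<^sup>2 / (A * B * D)" by (simp add: power3_eq_cube power2_eq_square)
  also have "\<dots> = S / A + S / B + S / D" unfolding S using pos by (simp add: field_simps)
  finally show ?thesis using 1 2 by linarith
qed

lemma acute_triangle_pos:
  fixes a b d :: real
  assumes "a \<ge> 0" "b \<ge> 0" "d \<ge> 0" "a\<^sup>2 < b\<^sup>2 + d\<^sup>2" "b\<^sup>2 < a\<^sup>2 + d\<^sup>2" "d\<^sup>2 < a\<^sup>2 + b\<^sup>2"
  shows "a > 0" "b > 0" "d > 0" "a < b + d" "b < a + d" "d < a + b"
proof -
  show "a > 0" "b > 0" "d > 0" using assms by (auto simp: less_le)
  have *: "x < y + w" if "x\<^sup>2 < y\<^sup>2 + w\<^sup>2" "y \<ge> 0" "w \<ge> 0" for x y w :: real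
  proof -
    have "0 \<le> 2 * y * w" using that by simp
    then have "x\<^sup>2 < (y + w)\<^sup>2" using that unfolding power2_sum by linarith
    then show ?thesis using that by (simp add: power2_less_imp_less)
  qed
  show "a < b + d" "b < a + d" "d < a + b" using assms by (auto intro: *)
qed

lemma dual_xnorm_eq_circumdiameter:
  fixes c :: "complex ^ 4"
  defines "a \<equiv> cmod (c $ 1)" and "b \<equiv> cmod (c $ 2)" and "d \<equiv> cmod (c $ 3)"
  assumes "c $ 4 = 0" and acute: "a\<^sup>2 < b\<^sup>2 + d\<^sup>2" "b\<^sup>2 < a\<^sup>2 + d\<^sup>2" "d\<^sup>2 < a\<^sup>2 + b\<^sup>2"
  shows "dual_xnorm c = 2 * (a * b * d) /
    sqrt ((a + b + d) * (- a + b + d) * (a - b + d) * (a + b - d))"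
proof -
  have tri: "a > 0" "b > 0" "d > 0" "a < b + d" "b < a + d" "d < a + b"
    using acute_triangle_pos[OF _ _ _ acute] by (simp_all add: a_def b_def d_def)
  define Q where "Q = (a + b + d) * (- a + b + d) * (a - b + d) * (a + b - d)"
  define S where "S = sqrt Q"
  have "Q > 0" unfolding Q_def using tri by (intro mult_pos_pos) simp_all
  then have S: "S > 0" "S\<^sup>2 = (a + b + d) * (- a + b + d) * (a - b + d) * (a + b - d)"
    by (simp_all add: S_def Q_def)
  define r where "r = 2 * (a * b * d) / S"
  have "r > 0" using tri S by (simp add: r_def)
  have "dual_xnorm c \<le> r"
  proof (rule dual_xnorm_le_if_dual_ball[OF \<open>r > 0\<close> _ \<open>c $ 4 = 0\<close>])
    have "x / r = x * (S / (2 * a * b * d))" for x by (simp add: r_def mult.assoc)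
    then show "dual_ball (cmod (c $ 1) / r) (cmod (c $ 2) / r) (cmod (c $ 3) / r)"
      using dual_ball_triangle[OF tri(1-3) S] by (simp only: a_def b_def d_def)
  qed
  moreover have "r \<le> dual_xnorm c"
  proof -
    define A B D where "A = b\<^sup>2 + d\<^sup>2 - a\<^sup>2" and "B = a\<^sup>2 + d\<^sup>2 - b\<^sup>2" and "D = a\<^sup>2 + b\<^sup>2 - d\<^sup>2"
    have pos: "A > 0" "B > 0" "D > 0" using acute by (simp_all add: A_def B_def D_def)
    have SS: "S\<^sup>2 = A * B + B * D + D * A" unfolding S A_def B_def D_def by algebra
    have sq: "(2 * b * d)\<^sup>2 = S\<^sup>2 + A\<^sup>2" "(2 * a * d)\<^sup>2 = S\<^sup>2 + B\<^sup>2" "(2 * a * b)\<^sup>2 = S\<^sup>2 + D\<^sup>2"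
      unfolding S A_def B_def D_def by algebra+
    have hl: "(2 * a * d) * (2 * a * b) = (2 * b * d) * (B + D)"
      unfolding B_def D_def by algebra
    define e1 e2 e3 where "e1 = sgn (c $ 1)" and "e2 = sgn (c $ 2)" and "e3 = sgn (c $ 3)"
    have e: "cmod e1 = 1" "cmod e2 = 1" "cmod e3 = 1"
      using tri by (auto simp: a_def b_def d_def e1_def e2_def e3_def norm_sgn)
    have ce: "c $ 1 = e1 * of_real a" "c $ 2 = e2 * of_real b" "c $ 3 = e3 * of_real d"
      using tri by (auto simp: a_def b_def d_def e1_def e2_def e3_def sgn_eq)
    note c1 = unit_mult_cnj
    \<comment> \<open>The first three phases cancel those of \<open>c\<close>, so the pairing is a
      sum of positive reals. The phase of the fourth entry makes both summands of
      \<open>xphase\<close> depend on the same \<open>u\<close>.\<close>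
    define z :: "complex ^ 4" where "z = (\<chi> i. if i = 1 then cnj e1 * of_real (2 * b * d / A)
      else if i = 2 then cnj e2 * of_real (2 * a * d / B)
      else if i = 3 then cnj e3 * of_real (2 * a * b / D) else - (e1 * cnj e2 * cnj e3))"
    have z: "z $ 1 = cnj e1 * of_real (2 * b * d / A)" "z $ 2 = cnj e2 * of_real (2 * a * d / B)"
      "z $ 3 = cnj e3 * of_real (2 * a * b / D)" "z $ 4 = - (e1 * cnj e2 * cnj e3)"
      by (simp_all add: z_def)
    have "xphase z s \<le> S ^ 3 / (A * B * D)" for s
    proof -
      define v where "v = exp (\<i> * of_real s)"
      define u where "u = cnj e2 * cnj e3 * v"
      have v: "cmod v = 1" by (simp add: v_def)
      have u: "cmod u = 1" using e v by (simp add: u_def norm_mult)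
      have "z $ 1 * v + cnj (z $ 4) =
          cnj e1 * ((e2 * cnj e2) * (e3 * cnj e3)) * v * of_real (2 * b * d / A) - cnj e1 * e2 * e3"
        using c1[OF e(2)] c1[OF e(3)] by (simp add: z mult_ac)
      also have "\<dots> = (cnj e1 * e2 * e3) * (u * of_real (2 * b * d / A) + of_real (- 1))"
        unfolding u_def by (simp add: algebra_simps)
      finally have 1: "cmod (z $ 1 * v + cnj (z $ 4)) = cmod (u * of_real (2 * b * d / A) + of_real (- 1))"
        using e by (simp only: norm_mult complex_mod_cnj mult_1)
      have "z $ 2 * v + cnj (z $ 3) =
          cnj e2 * (e3 * cnj e3) * v * of_real (2 * a * d / B) + e3 * of_real (2 * a * b / D)"
        using c1[OF e(3)] by (simp add: z mult_ac)
      also have "\<dots> = e3 * (u * of_real (2 * a * d / B) + of_real (2 * a * b / D))"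
        unfolding u_def by (simp add: algebra_simps)
      finally have 2: "cmod (z $ 2 * v + cnj (z $ 3)) =
          cmod (u * of_real (2 * a * d / B) + of_real (2 * a * b / D))"
        using e by (simp only: norm_mult mult_1)
      show ?thesis
        unfolding xphase_def v_def[symmetric] 1 2
        by (rule extremal_xphase_le[OF pos S(1) SS sq hl u])
    qed
    then have zx: "xnorm z \<le> S ^ 3 / (A * B * D)"
      unfolding xnorm_def by (intro cSUP_least) auto
    have "pairing c z = of_real (2 * a * b * d / A) + of_real (2 * a * b * d / B) + of_real (2 * a * b * d / D)"
    proof -
      have "pairing c z = (e1 * cnj e1) * of_real (2 * a * b * d / A) + (e2 * cnj e2) * of_real (2 * a * b * d / B)
         + (e3 * cnj e3) * of_real (2 * a * b * d / D)"
        using \<open>c $ 4 = 0\<close> by (simp add: pairing_def sum_4 ce z mult_ac)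
      then show ?thesis using c1 e by simp
    qed
    also have "\<dots> = of_real (2 * a * b * d / A + 2 * a * b * d / B + 2 * a * b * d / D)" by simp
    also have "2 * a * b * d / A + 2 * a * b * d / B + 2 * a * b * d / D
       = 2 * a * b * d * (A * B + B * D + D * A) / (A * B * D)" using pos by (simp add: field_simps)
    \<comment> \<open>The pairing is exactly \<open>r\<close> times the bound \<open>zx\<close> on
      \<open>xnorm z\<close>, which gives the lower bound \<open>r\<close>.\<close>
    also have "\<dots> = r * (S ^ 3 / (A * B * D))"
      unfolding SS[symmetric] r_def using S(1) by (simp add: power3_eq_cube power2_eq_square)
    finally have "pairing c z = of_real (r * (S ^ 3 / (A * B * D)))" .
    moreover have "r * (S ^ 3 / (A * B * D)) > 0" using \<open>r > 0\<close> S(1) pos by simp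
    ultimately have "cmod (pairing c z) = r * (S ^ 3 / (A * B * D))"
      by (simp only: norm_of_real abs_of_pos)
    then have "r * (S ^ 3 / (A * B * D)) \<le> dual_xnorm c * xnorm z"
      using cmod_pairing_le_dual[of c z] by simp
    also have "\<dots> \<le> dual_xnorm c * (S ^ 3 / (A * B * D))"
    proof (rule mult_left_mono[OF zx])
      show "0 \<le> dual_xnorm c" using linfnorm_le_dual_xnorm[of c] cmod_le_linfnorm[of c 1]
        norm_ge_zero[of "c $ 1"] by linarith
    qed
    finally show ?thesis by (rule mult_right_le_imp_le) (use S(1) pos in simp)
  qed
  ultimately show ?thesis unfolding S_def[symmetric] Q_def[symmetric] r_def by simp
qed

section \<open>Angles in terms of side lengths\<close>

text \<open>On \<open>[- 1, 1]\<close> the function \<open>arccos\<close> decreases strictly and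
  takes \<open>pi / 2\<close> at 0, so the sign of the cosine decides.\<close>

lemma opp_angle_less_right_iff:
  assumes "makes_triangle a b c"
  shows "opp_angle a b c < pi / 2 \<longleftrightarrow> a\<^sup>2 < b\<^sup>2 + c\<^sup>2"
proof -
  have tri: "a < b + c" "b < a + c" "c < a + b" using assms by (simp_all add: makes_triangle_def)
  then have pos: "a > 0" "b > 0" "c > 0" by linarith+
  define t where "t = (b\<^sup>2 + c\<^sup>2 - a\<^sup>2) / (2 * b * c)"
  then have bc: "2 * b * c > 0" using pos by simp
  \<comment> \<open>These products are \<open>2 * b * c\<close> plus and minus
    \<open>b\<^sup>2 + c\<^sup>2 - a\<^sup>2\<close>; they place the cosine between -1 and
    1.\<close>
  have "0 < (b + c - a) * (a + b + c)" "0 < (a + b - c) * (a + c - b)" using tri pos by simp_all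
  then have "\<bar>b\<^sup>2 + c\<^sup>2 - a\<^sup>2\<bar> \<le> 2 * b * c"
    by (simp add: abs_le_iff algebra_simps power2_eq_square)
  then have "\<bar>t\<bar> \<le> 1" using bc by (simp add: t_def)
  then have "opp_angle a b c < pi / 2 \<longleftrightarrow> 0 < t"
    unfolding opp_angle_def t_def[symmetric] using arccos_less_mono[of t 0] by simp
  also have "\<dots> \<longleftrightarrow> a\<^sup>2 < b\<^sup>2 + c\<^sup>2" using bc by (auto simp: t_def zero_less_divide_iff)
  finally show ?thesis .
qed

text \<open>Where there is no triangle both sides fail, because the inequalities between squares
  force the triangle inequalities.\<close>

lemma makes_acute_triangle_iff:
  assumes "a \<ge> 0" "b \<ge> 0" "c \<ge> 0"
  shows "makes_acute_triangle a b c \<longleftrightarrow> a\<^sup>2 < b\<^sup>2 + c\<^sup>2 \<and> b\<^sup>2 < a\<^sup>2 + c\<^sup>2 \<and> c\<^sup>2 < a\<^sup>2 + b\<^sup>2"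
    (is "_ \<longleftrightarrow> ?acute")
proof (cases "makes_triangle a b c")
  case True
  then have "makes_triangle b c a" "makes_triangle c a b" by (auto simp: makes_triangle_def)
  note opp = this[THEN opp_angle_less_right_iff] opp_angle_less_right_iff[OF True]
  have "largest_angle a b c < pi / 2 \<longleftrightarrow>
      opp_angle a b c < pi / 2 \<and> opp_angle b c a < pi / 2 \<and> opp_angle c a b < pi / 2"
    unfolding largest_angle_def by (subst Max_less_iff) auto
  with True show ?thesis unfolding opp makes_acute_triangle_def by (auto simp: add.commute)
next
  case False
  then have "\<not> ?acute" using acute_triangle_pos[of a b c] assms by (auto simp: makes_triangle_def)
  with False show ?thesis by (simp add: makes_acute_triangle_def)
qed

lemma not_makes_acute_triangle_iff:
  "\<not> makes_acute_triangle a b c \<longleftrightarrow>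
    \<not> makes_triangle a b c \<or> makes_obtuse_triangle a b c \<or> makes_right_triangle a b c"
  by (auto simp: makes_acute_triangle_def makes_obtuse_triangle_def makes_right_triangle_def)

section \<open>Symmetries and reduction to a vanishing fourth entry\<close>

text \<open>In the pairing the involution moves from \<open>c\<close> to \<open>z\<close> and keeps
  the norm of \<open>z\<close>. This gives one inequality; its instance at the permuted vector is
  the reverse.\<close>

lemma dual_xnorm_reindex:
  fixes c :: "complex ^ 4"
  assumes inv: "\<And>i. f (f i) = i" and f: "\<And>z s. xphase (\<chi> i. z $ f i) s = xphase z s"
  shows "dual_xnorm (\<chi> i. c $ f i) = dual_xnorm c"
proof -
  have le: "dual_xnorm (\<chi> i. c $ f i) \<le> dual_xnorm c" for c
  proof (rule dual_xnorm_le)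
    fix z
    have "bij f" using inv by (rule involuntory_imp_bij)
    then have "pairing (\<chi> i. c $ f i) z = pairing c (\<chi> i. z $ f i)"
      unfolding pairing_def using sum.reindex_bij_betw[of f UNIV UNIV "\<lambda>i. c $ i * z $ f i"]
      by (simp add: inv)
    moreover have "xnorm (\<chi> i. z $ f i) = xnorm z" by (simp add: xnorm_def f)
    ultimately show "cmod (pairing (\<chi> i. c $ f i) z) \<le> dual_xnorm c * xnorm z"
      using cmod_pairing_le_dual[of c "\<chi> i. z $ f i"] by simp
  qed
  from le[of c] le[of "\<chi> i. c $ f i"] show ?thesis by (simp add: inv)
qed

lemma linfnorm_reindex:
  fixes c :: "complex ^ 4"
  assumes inv: "\<And>i. f (f i) = i"
  shows "linfnorm (\<chi> i. c $ f i) = linfnorm c"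
proof -
  have "surj f" using involuntory_imp_bij[of f] inv by (simp add: bij_def)
  then have "range (\<lambda>i. cmod (c $ f i)) = range (\<lambda>i. cmod (c $ i))"
    by (metis image_image)
  then show ?thesis by (simp add: linfnorm_def)
qed

text \<open>
  The element of the Klein four-group that exchanges \<open>l\<close> and \<open>4\<close>; these permutations
  preserve the norm.
\<close>

definition klein_swap :: "4 \<Rightarrow> 4 \<Rightarrow> 4" where
  "klein_swap l i = (if l = 4 then i
     else if l = 1 then (if i = 1 then 4 else if i = 2 then 3 else if i = 3 then 2 else 1)
     else if l = 2 then (if i = 1 then 3 else if i = 2 then 4 else if i = 3 then 1 else 2)
     else (if i = 1 then 2 else if i = 2 then 1 else if i = 3 then 4 else 3))"

lemma klein_swap_involution: "klein_swap l (klein_swap l i) = i"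
  using exhaust_4[of i] exhaust_4[of l] by (elim disjE) (simp_all add: klein_swap_def)

lemma cmod_mult_unit_add_cnj_commute:
  assumes "cmod u = 1"
  shows "cmod (a * u + cnj b) = cmod (b * u + cnj a)"
proof -
  have "cnj (b * u + cnj a) * u = cnj b * (u * cnj u) + a * u" by (simp add: algebra_simps)
  then have "cnj (b * u + cnj a) * u = a * u + cnj b" using assms by (simp add: unit_mult_cnj)
  then show ?thesis using assms by (metis complex_mod_cnj mult.right_neutral norm_mult)
qed

text \<open>Each nontrivial swap exchanges the two summands, or the entries within each summand, or
  does both.\<close>

lemma xphase_klein_swap: "xphase (\<chi> i. z $ klein_swap l i) s = xphase z s"
proof -
  have "cmod (exp (\<i> * of_real s)) = 1" by simp
  note comm = cmod_mult_unit_add_cnj_commute[OF this]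
  show ?thesis
    using exhaust_4[of l] comm[of "z $ 1" "z $ 4"] comm[of "z $ 2" "z $ 3"]
    by (elim disjE) (simp_all add: xphase_def klein_swap_def)
qed

text \<open>The order obtained depends on the given indices; all 256 choices are checked.\<close>

lemma klein_swap_indices:
  assumes "{i, j, k, l} = {1, 2, 3, 4 :: 4}"
  shows "(klein_swap l 1, klein_swap l 2, klein_swap l 3) \<in>
    {(i, j, k), (i, k, j), (j, i, k), (j, k, i), (k, i, j), (k, j, i)}"
  using exhaust_4[of i] exhaust_4[of j] exhaust_4[of k] exhaust_4[of l] assms
  by (elim disjE) (simp_all add: klein_swap_def set_eq_iff forall_4)

theorem theorem4p2:
  fixes c :: "complex ^ 4" and i j k l :: 4
  assumes "{i, j, k, l} = {1, 2, 3, 4}"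
    and "c $ l = 0"
  shows "(\<not> makes_triangle (cmod (c $ i)) (cmod (c $ j)) (cmod (c $ k)) \<or>
          makes_obtuse_triangle (cmod (c $ i)) (cmod (c $ j)) (cmod (c $ k)) \<or>
          makes_right_triangle (cmod (c $ i)) (cmod (c $ j)) (cmod (c $ k))
            \<longrightarrow> dual_xnorm c = linfnorm c) \<and>
         (makes_acute_triangle (cmod (c $ i)) (cmod (c $ j)) (cmod (c $ k))
            \<longrightarrow> dual_xnorm c =
              2 * cmod (c $ i * c $ j * c $ k) /
              sqrt ((cmod (c $ i) + cmod (c $ j) + cmod (c $ k)) *
                    (- cmod (c $ i) + cmod (c $ j) + cmod (c $ k)) *
                    (cmod (c $ i) - cmod (c $ j) + cmod (c $ k)) *
                    (cmod (c $ i) + cmod (c $ j) - cmod (c $ k))))"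
proof -
  define acute where "acute = (\<lambda>a b d :: real. a\<^sup>2 < b\<^sup>2 + d\<^sup>2 \<and> b\<^sup>2 < a\<^sup>2 + d\<^sup>2 \<and> d\<^sup>2 < a\<^sup>2 + b\<^sup>2)"
  define R where "R = (\<lambda>a b d :: real. 2 * (a * b * d) /
    sqrt ((a + b + d) * (- a + b + d) * (a - b + d) * (a + b - d)))"
  \<comment> \<open>Both cases form one statement that is symmetric in its arguments, so the order
    of the three moduli is immaterial.\<close>
  define C where "C = (\<lambda>a b d. dual_xnorm c = (if acute a b d then R a b d else linfnorm c))"
  have "acute b a d = acute a b d" "acute a d b = acute a b d" for a b d
    by (auto simp: acute_def add.commute)
  moreover have "R b a d = R a b d" "R a d b = R a b d" for a b d
    by (simp_all add: R_def algebra_simps)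
  ultimately have C: "C b a d = C a b d" "C a d b = C a b d" for a b d
    by (simp_all add: C_def)
  \<comment> \<open>Exchanging \<open>l\<close> and 4 moves the zero entry to the fourth
    place.\<close>
  define c' where "c' = (\<chi> i. c $ klein_swap l i)"
  have dual: "dual_xnorm c' = dual_xnorm c"
    unfolding c'_def by (rule dual_xnorm_reindex[OF klein_swap_involution xphase_klein_swap])
  have linf: "linfnorm c' = linfnorm c"
    unfolding c'_def by (rule linfnorm_reindex[OF klein_swap_involution])
  have "c' $ 4 = 0" using exhaust_4[of l] assms(2) by (auto simp: c'_def klein_swap_def)
  then have "C (cmod (c' $ 1)) (cmod (c' $ 2)) (cmod (c' $ 3))"
    using dual_xnorm_eq_linfnorm[of c'] dual_xnorm_eq_circumdiameter[of c']
    unfolding C_def dual linf acute_def R_def by (auto simp: not_less)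
  then have *: "C (cmod (c $ i)) (cmod (c $ j)) (cmod (c $ k))"
    using klein_swap_indices[OF assms(1)] C unfolding c'_def by auto
  show ?thesis
    using * unfolding not_makes_acute_triangle_iff[symmetric] C_def acute_def R_def
    by (simp add: makes_acute_triangle_iff norm_mult)
qed

end
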